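(* Let $R$ be an integral domain. If $R$ satisfies the $\ast$-property, then $R$ is a field.
   Context: All rings are commutative with identity. A ring $R$ is said to satisfy the $\ast$-property if for every family $\{I_\alpha\}_{\alpha\in S}$ of ideals of $R$ (with $S$ an arbitrary index set) there exists a finite subset $S'\subseteq S$ such that $\sqrt{\bigcap_{\alpha\in S} I_\alpha}=\bigcap_{\alpha\in S'}\sqrt{I_\alpha}$, where $\sqrt{I}$ denotes the radical of the ideal $I$. *)

theory Defs
  imports "HOL-Algebra.Ideal"
begin

definition ideal_radical :: "('a, 'b) ring_scheme \<Rightarrow> 'a set \<Rightarrow> 'a set" where
  "ideal_radical R I = {x \<in> carrier R. \<exists>n::nat. n \<ge> 1 \<and> x [^]\<^bsub>R\<^esub> n \<in> I}"

(* Intersecting with the carrier only affects empty index sets: the empty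
   intersection of ideals is the whole ring, not UNIV. *)
definition ideal_Inter :: "('a, 'b) ring_scheme \<Rightarrow> 'i set \<Rightarrow> ('i \<Rightarrow> 'a set) \<Rightarrow> 'a set" where
  "ideal_Inter R S I = carrier R \<inter> (\<Inter>\<alpha>\<in>S. I \<alpha>)"

(* HOL cannot quantify over index types inside a definition. Index sets are drawn
   from 'a set, which is large enough to index every collection of ideals;
   star_property_family below gives the property for families over an arbitrary
   index type. *)
definition star_property :: "('a, 'b) ring_scheme \<Rightarrow> bool" where
  "star_property R \<longleftrightarrow>
     (\<forall>(S :: 'a set set) (I :: 'a set \<Rightarrow> 'a set).
        (\<forall>\<alpha>\<in>S. ideal (I \<alpha>) R) \<longrightarrow>
        (\<exists>S'. finite S' \<and> S' \<subseteq> S \<and>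
           ideal_radical R (ideal_Inter R S I) =
             ideal_Inter R S' (\<lambda>\<alpha>. ideal_radical R (I \<alpha>))))"

lemma star_property_family:
  fixes R :: "('a, 'b) ring_scheme" and S :: "'i set" and I :: "'i \<Rightarrow> 'a set"
  assumes "star_property R" and ideals: "\<And>\<alpha>. \<alpha> \<in> S \<Longrightarrow> ideal (I \<alpha>) R"
  shows "\<exists>S'. finite S' \<and> S' \<subseteq> S \<and>
           ideal_radical R (ideal_Inter R S I) =
             ideal_Inter R S' (\<lambda>\<alpha>. ideal_radical R (I \<alpha>))"
proof -
  have "\<forall>J\<in>I ` S. ideal J R" using ideals by blast
  then obtain T where T: "finite T" "T \<subseteq> I ` S"
    "ideal_radical R (ideal_Inter R (I ` S) (\<lambda>J. J)) = ideal_Inter R T (ideal_radical R)"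
    using assms(1)[unfolded star_property_def, rule_format, of "I ` S" "\<lambda>J. J"] by auto
  obtain S' where "S' \<subseteq> S" "finite S'" "T = I ` S'"
    using finite_subset_image[OF T(1,2)] by blast
  then show ?thesis using T(3) by (auto simp: ideal_Inter_def)
qed

end

(* If x is nonzero, x lies in the radical of every principal ideal (x^(n+1)), hence
   in every finite intersection of these radicals.  The star property then puts some
   power x^k into the intersection of all the ideals, in particular into (x^(k+1)),
   and cancelling x^k shows that x is a unit. *)
theory Submission
  imports Defs
begin

theorem theorem2:
  fixes R :: "('a, 'b) ring_scheme"
  assumes "domain R"
    and "star_property R"
  shows "field R"
proof -
  interpret domain R by fact
  show ?thesis
  proof (rule cring_fieldI2[OF zero_not_one])
    fix x assume x: "x \<in> carrier R" and nz: "x \<noteq> \<zero>\<^bsub>R\<^esub>"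
    \<comment> \<open>The exponent is one above the index, so that \<open>I k\<close> asks for one
      more factor \<open>x\<close> than the k-th power has.\<close>
    define I where "I = (\<lambda>n::nat. PIdl\<^bsub>R\<^esub> (x [^]\<^bsub>R\<^esub> Suc n))"
    have "ideal (I n) R" for n
      unfolding I_def using x by (intro cgenideal_ideal nat_pow_closed)
    \<comment> \<open>The family is indexed by \<open>nat\<close>, hence the form of the property
      for arbitrary index types.\<close>
    with star_property_family[OF assms(2), of UNIV I] obtain S' where
      S': "ideal_radical R (ideal_Inter R UNIV I) = ideal_Inter R S' (\<lambda>n. ideal_radical R (I n))"
      by blast
    have "x [^]\<^bsub>R\<^esub> Suc n \<in> I n" for n
      unfolding I_def using x by (intro cgenideal_self nat_pow_closed)
    then have "x \<in> ideal_radical R (I n)" for n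
      unfolding ideal_radical_def using x by (intro CollectI conjI exI[of _ "Suc n"]) simp_all
    \<comment> \<open>For empty \<open>S'\<close> the right-hand side of \<open>S'\<close> is the
      carrier, which contains \<open>x\<close> too.\<close>
    then have "x \<in> ideal_radical R (ideal_Inter R UNIV I)"
      unfolding S' using x by (simp add: ideal_Inter_def)
    \<comment> \<open>Diagonal choice: the exponent \<open>k\<close> supplied by the radical also
      serves as the index of the ideal.\<close>
    then obtain k :: nat where "x [^]\<^bsub>R\<^esub> k \<in> I k"
      unfolding ideal_radical_def ideal_Inter_def by blast
    then obtain y where y: "y \<in> carrier R"
      and eq: "x [^]\<^bsub>R\<^esub> k = y \<otimes>\<^bsub>R\<^esub> x [^]\<^bsub>R\<^esub> Suc k"
      unfolding I_def cgenideal_def by blast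
    have "x [^]\<^bsub>R\<^esub> k \<otimes>\<^bsub>R\<^esub> (y \<otimes>\<^bsub>R\<^esub> x) = y \<otimes>\<^bsub>R\<^esub> x [^]\<^bsub>R\<^esub> Suc k"
      using x y by (simp add: m_ac)
    then have "x [^]\<^bsub>R\<^esub> k \<otimes>\<^bsub>R\<^esub> (y \<otimes>\<^bsub>R\<^esub> x) = x [^]\<^bsub>R\<^esub> k \<otimes>\<^bsub>R\<^esub> \<one>\<^bsub>R\<^esub>"
      using x by (simp only: eq[symmetric] r_one nat_pow_closed)
    \<comment> \<open>In a domain powers of a nonzero element stay nonzero; this licenses the
      cancellation.\<close>
    moreover have "x [^]\<^bsub>R\<^esub> k \<noteq> \<zero>\<^bsub>R\<^esub>"
      using x nz by (induction k) (auto simp: integral_iff)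
    ultimately have "y \<otimes>\<^bsub>R\<^esub> x = \<one>\<^bsub>R\<^esub>"
      using m_lcancel[of "x [^]\<^bsub>R\<^esub> k" "y \<otimes>\<^bsub>R\<^esub> x" "\<one>\<^bsub>R\<^esub>"] x y by simp
    then show "\<exists>y\<in>carrier R. x \<otimes>\<^bsub>R\<^esub> y = \<one>\<^bsub>R\<^esub>"
      using y m_comm[OF x y] by metis
  qed
qed

end
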